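(* Let $\Bbbk$ be a field of characteristic $0$, let $n\ge3$, and let $\Omega\in A:=\Bbbk[t_1,\dots,t_{n+1}]$ be an irreducible element of degree at least $2$ (not necessarily homogeneous). Then, as subgroups of the group $\mathrm{Aut}_{alg}(A)$ of $\Bbbk$-algebra automorphisms of $A$, $$\mathrm{Aut}(A\mid\Bbbk^\times\Omega+\Bbbk)=\mathrm{Aut}_{\Bbbk^\times Poi}(A_\Omega).$$
   Context: $A_\Omega$ is the Nambu-Poisson algebra with underlying algebra $A=\Bbbk[t_1,\dots,t_{n+1}]$ and $n$-ary bracket $\{f_1,\dots,f_n\}=\det\frac{\partial(f_1,\dots,f_n,\Omega)}{\partial(t_1,\dots,t_{n+1})}$ (the Jacobian determinant whose last row is the gradient of $\Omega$). $\mathrm{Aut}(A\mid\Bbbk^\times\Omega+\Bbbk)=\{\sigma\in\mathrm{Aut}_{alg}(A)\mid\sigma(\Omega)=a\Omega+b\text{ for some }a\in\Bbbk^\times,\ b\in\Bbbk\}$. For a Nambu-Poisson algebra $B$ with bracket $\{-,\dots,-\}$ and $e\in\Bbbk^\times$, $B(e)$ denotes the algebra $B$ with the new bracket $e\{-,\dots,-\}$. An $\epsilon$-automorphism of $B$ is a $\Bbbk$-algebra automorphism $\phi$ of $B$ that is a Nambu-Poisson morphism $B\to B(e)$ for some $e\in\Bbbk^\times$, i.e. $\phi(\{f_1,\dots,f_n\})=e\{\phi(f_1),\dots,\phi(f_n)\}$ for all $f_i\in B$. $\mathrm{Aut}_{\Bbbk^\times Poi}(B)$ is the group of all $\epsilon$-automorphisms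 of $B$. *)

theory Defs
  imports
    "HOL-Library.Poly_Mapping"
    "HOL-Analysis.Determinants"
    "HOL-Algebra.Group"
    "HOL-Computational_Algebra.Factorial_Ring"
begin

text \<open>
  The polynomial ring in finitely many variables indexed by \<open>'v\<close>: finitely supported functions
  from exponent vectors to coefficients, with convolution as product.
\<close>

type_synonym ('v, 'k) mpoly = "('v \<Rightarrow>\<^sub>0 nat) \<Rightarrow>\<^sub>0 'k"

definition mconst :: "'k::zero \<Rightarrow> ('v, 'k) mpoly" where
  "mconst c = Poly_Mapping.single 0 c"

text \<open>Convention: the zero polynomial has total degree 0.\<close>

definition total_degree :: "('v::finite, 'k::zero) mpoly \<Rightarrow> nat" where
  "total_degree p = Max (insert 0 ((\<lambda>m. \<Sum>v\<in>UNIV. Poly_Mapping.lookup m v) ` Poly_Mapping.keys p))"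

text \<open>
  In \<open>partial\<close>, the truncated subtraction on exponents is harmless: the monomials in which
  \<open>v\<close> does not occur carry the factor 0.
\<close>

definition partial :: "'v \<Rightarrow> ('v, 'k::comm_ring_1) mpoly \<Rightarrow> ('v, 'k) mpoly" where
  "partial v p = (\<Sum>m\<in>Poly_Mapping.keys p. Poly_Mapping.single
      (m - Poly_Mapping.single v 1) (of_nat (Poly_Mapping.lookup m v) * Poly_Mapping.lookup p m))"

definition jacobian :: "('v::finite \<Rightarrow> ('v, 'k::comm_ring_1) mpoly) \<Rightarrow> ('v, 'k) mpoly" where
  "jacobian f = det (\<chi> i j. partial j (f i))"

text \<open>
  With \<open>n = CARD('m)\<close>, the \<open>n + 1\<close> variables are indexed by \<open>'m option\<close>: \<open>Some i\<close> for
  \<open>i :: 'm\<close> stands for the first \<open>n\<close> indices and \<open>None\<close> for the index \<open>n + 1\<close>, for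
  variables (columns) and for the entries \<open>f\<^sub>1, \<dots>, f\<^sub>n, \<Omega>\<close> (rows) alike. Since rows and columns
  are numbered by the same type, the determinant does not depend on how that type is enumerated.
  An \<open>n\<close>-ary bracket is a function on families indexed by \<open>'m\<close>.
\<close>

definition nambu_bracket ::
    "('m::finite option, 'k::comm_ring_1) mpoly \<Rightarrow>
      ('m \<Rightarrow> ('m option, 'k) mpoly) \<Rightarrow> ('m option, 'k) mpoly" where
  "nambu_bracket \<Omega> f = jacobian (case_option \<Omega> f)"

definition alg_hom :: "(('v, 'k::comm_ring_1) mpoly \<Rightarrow> ('v, 'k) mpoly) \<Rightarrow> bool" where
  "alg_hom \<phi> \<longleftrightarrow> \<phi> 1 = 1 \<and> (\<forall>p q. \<phi> (p + q) = \<phi> p + \<phi> q) \<and> (\<forall>p q. \<phi> (p * q) = \<phi> p * \<phi> q)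
     \<and> (\<forall>c p. \<phi> (mconst c * p) = mconst c * \<phi> p)"

definition Aut_alg :: "(('v, 'k::comm_ring_1) mpoly \<Rightarrow> ('v, 'k) mpoly) monoid" where
  "Aut_alg = \<lparr>carrier = {\<sigma>. alg_hom \<sigma> \<and> bij \<sigma>}, mult = (\<circ>), one = id\<rparr>"

text \<open>The group \<open>Aut(A | k\<^sup>\<times> \<Omega> + k)\<close>.\<close>

definition Aut_affine ::
    "('v, 'k::field) mpoly \<Rightarrow> (('v, 'k) mpoly \<Rightarrow> ('v, 'k) mpoly) set" where
  "Aut_affine \<Omega> = {\<sigma> \<in> carrier Aut_alg. \<exists>a b. a \<noteq> 0 \<and> \<sigma> \<Omega> = mconst a * \<Omega> + mconst b}"

text \<open>
  The following notions concern brackets \<open>br\<close> (with arguments indexed by \<open>'i\<close>) on the polynomial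
  algebra; \<open>scaled_bracket e br\<close> is the bracket of \<open>B(e)\<close> when \<open>br\<close> is that of \<open>B\<close>.
\<close>

definition scaled_bracket ::
    "'k::comm_ring_1 \<Rightarrow> (('i \<Rightarrow> ('v, 'k) mpoly) \<Rightarrow> ('v, 'k) mpoly) \<Rightarrow>
      (('i \<Rightarrow> ('v, 'k) mpoly) \<Rightarrow> ('v, 'k) mpoly)" where
  "scaled_bracket e br = (\<lambda>f. mconst e * br f)"

definition nambu_poisson_morphism ::
    "(('i \<Rightarrow> ('v, 'k::comm_ring_1) mpoly) \<Rightarrow> ('v, 'k) mpoly) \<Rightarrow>
      (('i \<Rightarrow> ('v, 'k) mpoly) \<Rightarrow> ('v, 'k) mpoly) \<Rightarrow> (('v, 'k) mpoly \<Rightarrow> ('v, 'k) mpoly) \<Rightarrow> bool" where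
  "nambu_poisson_morphism br br' \<phi> \<longleftrightarrow> alg_hom \<phi> \<and> (\<forall>f. \<phi> (br f) = br' (\<lambda>i. \<phi> (f i)))"

text \<open>The group \<open>Aut\<^bsub>k\<^sup>\<times> Poi\<^esub>(B)\<close> of \<open>\<epsilon>\<close>-automorphisms.\<close>

definition Aut_eps_Poi ::
    "(('i \<Rightarrow> ('v, 'k::field) mpoly) \<Rightarrow> ('v, 'k) mpoly) \<Rightarrow>
      (('v, 'k) mpoly \<Rightarrow> ('v, 'k) mpoly) set" where
  "Aut_eps_Poi br = {\<phi> \<in> carrier Aut_alg.
     \<exists>e. e \<noteq> 0 \<and> nambu_poisson_morphism br (scaled_bracket e br) \<phi>}"

lemma alg_hom_comp: "alg_hom \<sigma> \<Longrightarrow> alg_hom \<tau> \<Longrightarrow> alg_hom (\<sigma> \<circ> \<tau>)"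
  unfolding alg_hom_def o_def by metis

lemma group_Aut_alg: "group (Aut_alg :: (('v, 'k::comm_ring_1) mpoly \<Rightarrow> ('v, 'k) mpoly) monoid)"
proof (rule groupI)
  fix \<sigma> :: "('v, 'k) mpoly \<Rightarrow> ('v, 'k) mpoly"
  assume "\<sigma> \<in> carrier Aut_alg"
  hence hom: "alg_hom \<sigma>" and bij: "bij \<sigma>" by (auto simp: Aut_alg_def)
  have s: "\<sigma> (inv_into UNIV \<sigma> x) = x" for x
    using bij by (simp add: bij_is_surj surj_f_inv_f)
  have e: "inv_into UNIV \<sigma> y = x" if "\<sigma> x = y" for x y
    using bij that by (auto simp: bij_is_inj)
  have "alg_hom (inv_into UNIV \<sigma>)"
    unfolding alg_hom_def using hom by (auto intro!: e simp: alg_hom_def s)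
  moreover have "bij (inv_into UNIV \<sigma>)" using bij by (rule bij_imp_bij_inv)
  moreover have "inv_into UNIV \<sigma> \<circ> \<sigma> = id" using bij by (simp add: bij_is_inj)
  ultimately show "\<exists>\<tau>\<in>carrier Aut_alg. \<tau> \<otimes>\<^bsub>Aut_alg\<^esub> \<sigma> = \<one>\<^bsub>Aut_alg\<^esub>"
    by (auto simp: Aut_alg_def)
next
  show "\<one>\<^bsub>Aut_alg\<^esub> \<in> carrier Aut_alg" by (simp add: Aut_alg_def alg_hom_def)
qed (auto simp: Aut_alg_def alg_hom_comp bij_comp comp_assoc)

lemma lookup_partial:
  "Poly_Mapping.lookup (partial v p) m =
     of_nat (Suc (Poly_Mapping.lookup m v)) * Poly_Mapping.lookup p (m + Poly_Mapping.single v 1)"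
proof -
  let ?s = "Poly_Mapping.single v (1::nat)"
  have inner: "Poly_Mapping.lookup (Poly_Mapping.single (k - ?s)
        (of_nat (Poly_Mapping.lookup k v) * Poly_Mapping.lookup p k)) m =
      (if k = m + ?s then of_nat (Suc (Poly_Mapping.lookup m v)) * Poly_Mapping.lookup p k else 0)"
    for k
  proof (cases "Poly_Mapping.lookup k v = 0")
    case True
    hence "k \<noteq> m + ?s" by (auto simp: lookup_add)
    thus ?thesis using True by (simp add: lookup_single)
  next
    case False
    hence "(k - ?s) + ?s = k"
      by (intro poly_mapping_eqI) (auto simp: lookup_add lookup_minus lookup_single when_def)
    hence "k - ?s = m \<longleftrightarrow> k = m + ?s" by auto
    thus ?thesis by (auto simp: lookup_single when_def lookup_add)
  qed
  show ?thesis
    unfolding partial_def lookup_sum inner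
    by (simp add: sum.delta in_keys_iff)
qed

end

theory Submission
  imports Defs
begin

text \<open>
  By the chain rule, an algebra endomorphism \<open>\<sigma>\<close> satisfies
  \<open>J(\<sigma> f\<^sub>1, \<dots>, \<sigma> f\<^sub>n, \<sigma> \<Omega>) = \<sigma> (J(f\<^sub>1, \<dots>, f\<^sub>n, \<Omega>)) \<cdot> J(\<sigma>)\<close>, and for an automorphism the
  Jacobian \<open>J(\<sigma>)\<close> is a unit, hence a constant \<open>c \<noteq> 0\<close>. If \<open>\<sigma> \<Omega> = a \<Omega> + b\<close>, comparison of the
  last rows shows that \<open>\<sigma>\<close> rescales the bracket by \<open>a / c\<close>. Conversely, if \<open>\<sigma>\<close> rescales the bracket
  by \<open>e\<close>, then \<open>\<Psi> = \<sigma> \<Omega> - e c \<Omega>\<close> satisfies \<open>J(g\<^sub>1, \<dots>, g\<^sub>n, \<Psi>) = 0\<close> for all \<open>g\<close>; choosing for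
  \<open>g\<close> all variables but one, every partial derivative of \<open>\<Psi>\<close> vanishes, so that \<open>\<Psi>\<close> is constant.
\<close>

section \<open>Polynomials as sums of monomials\<close>

lemma poly_mapping_sum_single:
  "p = (\<Sum>m\<in>Poly_Mapping.keys p. Poly_Mapping.single m (Poly_Mapping.lookup p m))"
  by (rule poly_mapping_eqI)
    (auto simp: lookup_sum lookup_single when_def in_keys_iff)

text \<open>A finitely supported function is a finite sum of singletons. The case 0 is the singleton
  with value 0. The rule serves both polynomials and exponent vectors.\<close>

lemma poly_mapping_add_induct [case_names single add]:
  fixes p :: "'a \<Rightarrow>\<^sub>0 'b::comm_monoid_add"
  assumes single: "\<And>m a. P (Poly_Mapping.single m a)"
    and add: "\<And>p q. P p \<Longrightarrow> P q \<Longrightarrow> P (p + q)"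
  shows "P p"
proof -
  have zero: "P 0" using single[of undefined 0] by simp
  have "P (\<Sum>m\<in>M. Poly_Mapping.single m (Poly_Mapping.lookup p m))" for M
    by (induction M rule: infinite_finite_induct) (auto intro: zero single add)
  then show ?thesis using poly_mapping_sum_single[of p] by metis
qed

lemma lookup_mult_keys:
  fixes p q :: "'a::monoid_add \<Rightarrow>\<^sub>0 'b::semiring_0"
  shows "Poly_Mapping.lookup (p * q) m =
    (\<Sum>k\<in>Poly_Mapping.keys p. \<Sum>l\<in>Poly_Mapping.keys q.
      (Poly_Mapping.lookup p k * Poly_Mapping.lookup q l when k + l = m))"
proof -
  have "p * q = (\<Sum>k\<in>Poly_Mapping.keys p. Poly_Mapping.single k (Poly_Mapping.lookup p k)) *
    (\<Sum>l\<in>Poly_Mapping.keys q. Poly_Mapping.single l (Poly_Mapping.lookup q l))"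
    using poly_mapping_sum_single[of p] poly_mapping_sum_single[of q] by simp
  then show ?thesis
    by (simp add: sum_product mult_single lookup_sum lookup_single)
qed

definition mvar :: "'v \<Rightarrow> ('v, 'k::comm_ring_1) mpoly" where
  "mvar v = Poly_Mapping.single (Poly_Mapping.single v 1) 1"

lemma mconst_0 [simp]: "mconst 0 = 0"
  and mconst_1 [simp]: "mconst 1 = 1"
  and mconst_add: "mconst (a + b) = mconst a + mconst b"
  and mconst_mult: "mconst (c * d) = mconst c * mconst d"
  by (simp_all add: mconst_def single_add mult_single)

text \<open>Constants and variables generate the polynomial ring, so identities compatible with sums
  and products need checking only there.\<close>

lemma mpoly_induct [case_names const var add mult]:
  fixes p :: "('v, 'k::comm_ring_1) mpoly"
  assumes const: "\<And>c. P (mconst c)"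
    and var: "\<And>v. P (mvar v)"
    and add: "\<And>p q. P p \<Longrightarrow> P q \<Longrightarrow> P (p + q)"
    and mult: "\<And>p q. P p \<Longrightarrow> P q \<Longrightarrow> P (p * q)"
  shows "P p"
proof (induction p rule: poly_mapping_add_induct)
  case (single m a)
  have one: "P 1" using const[of 1] by (simp add: mconst_def)
  have pow: "P (Poly_Mapping.single (Poly_Mapping.single v n) 1)" for v n
  proof (induction n)
    case (Suc n)
    have "Poly_Mapping.single (Poly_Mapping.single v (Suc n)) (1::'k) =
        mvar v * Poly_Mapping.single (Poly_Mapping.single v n) 1"
      by (simp add: mvar_def mult_single single_add[symmetric])
    then show ?case using mult[OF var Suc] by simp
  qed (simp add: one)
  \<comment> \<open>The exponent vector \<open>m\<close> is itself finitely supported, so additive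
    induction applies to it; adding exponents multiplies monomials.\<close>
  have mon: "P (Poly_Mapping.single m 1)"
  proof (induction m rule: poly_mapping_add_induct)
    case (add p q)
    then show ?case using mult[OF add] by (simp add: mult_single)
  qed (rule pow)
  have "Poly_Mapping.single m a = mconst a * Poly_Mapping.single m 1"
    by (simp add: mconst_def mult_single)
  then show ?case using mult[OF const mon] by simp
qed (rule add)

section \<open>Units\<close>

text \<open>The pair \<open>k\<^sub>0, l\<^sub>0\<close> is the pair of leading monomials for a lexicographic order.\<close>

lemma ex_unique_sum_lex:
  fixes K L :: "('v \<Rightarrow>\<^sub>0 nat) set"
  assumes "finite V" "finite K" "K \<noteq> {}" "finite L" "L \<noteq> {}"
    and "\<And>k k' v. k \<in> K \<Longrightarrow> k' \<in> K \<Longrightarrow> v \<notin> V \<Longrightarrow> Poly_Mapping.lookup k v = Poly_Mapping.lookup k' v"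
    and "\<And>l l' v. l \<in> L \<Longrightarrow> l' \<in> L \<Longrightarrow> v \<notin> V \<Longrightarrow> Poly_Mapping.lookup l v = Poly_Mapping.lookup l' v"
  shows "\<exists>k0\<in>K. \<exists>l0\<in>L. \<forall>k\<in>K. \<forall>l\<in>L. k + l = k0 + l0 \<longrightarrow> k = k0 \<and> l = l0"
  using assms
proof (induction V arbitrary: K L rule: finite_induct)
  case empty
  have "k = k'" if "k \<in> K" "k' \<in> K" for k k'
    using empty(5)[OF that] by (intro poly_mapping_eqI) auto
  moreover have "l = l'" if "l \<in> L" "l' \<in> L" for l l'
    using empty(6)[OF that] by (intro poly_mapping_eqI) auto
  ultimately show ?case using empty by blast
next
  case (insert v V)
  \<comment> \<open>Keeping only the elements with maximal exponent at \<open>v\<close> makes that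
    exponent constant on each set, so the induction hypothesis for \<open>V\<close> applies.\<close>
  define M where "M S = Max ((\<lambda>k. Poly_Mapping.lookup k v) ` S)" for S :: "('v \<Rightarrow>\<^sub>0 nat) set"
  define T where "T S = {k \<in> S. Poly_Mapping.lookup k v = M S}" for S
  have le: "Poly_Mapping.lookup k v \<le> M S" if "finite S" "k \<in> S" for S k
    unfolding M_def using that by auto
  have ne: "T S \<noteq> {}" if "finite S" "S \<noteq> {}" for S
  proof -
    have "M S \<in> (\<lambda>k. Poly_Mapping.lookup k v) ` S"
      unfolding M_def using that by (intro Max_in) auto
    then show ?thesis by (auto simp: T_def)
  qed
  have "\<exists>k0\<in>T K. \<exists>l0\<in>T L. \<forall>k\<in>T K. \<forall>l\<in>T L. k + l = k0 + l0 \<longrightarrow> k = k0 \<and> l = l0"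
  proof (rule insert.IH)
    show "Poly_Mapping.lookup k u = Poly_Mapping.lookup k' u" if "k \<in> T K" "k' \<in> T K" "u \<notin> V" for k k' u
      using that insert.prems(5)[of k k' u] by (cases "u = v") (auto simp: T_def)
    show "Poly_Mapping.lookup k u = Poly_Mapping.lookup k' u" if "k \<in> T L" "k' \<in> T L" "u \<notin> V" for k k' u
      using that insert.prems(6)[of k k' u] by (cases "u = v") (auto simp: T_def)
  qed (use insert.prems ne in \<open>auto simp: T_def\<close>)
  then obtain k0 l0 where kl: "k0 \<in> T K" "l0 \<in> T L"
    and uniq: "\<And>k l. k \<in> T K \<Longrightarrow> l \<in> T L \<Longrightarrow> k + l = k0 + l0 \<Longrightarrow> k = k0 \<and> l = l0"
    by blast
  have "k = k0 \<and> l = l0" if "k \<in> K" "l \<in> L" "k + l = k0 + l0" for k l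
  proof (rule uniq)
    \<comment> \<open>Neither exponent exceeds its maximum, so a sum equal to
      \<open>M K + M L\<close> forces both to be maximal.\<close>
    have "Poly_Mapping.lookup k v + Poly_Mapping.lookup l v = M K + M L"
      using that(3) kl by (metis (mono_tags, lifting) T_def lookup_add mem_Collect_eq)
    then have "Poly_Mapping.lookup k v = M K \<and> Poly_Mapping.lookup l v = M L"
      using le[of K k] le[of L l] that insert.prems by linarith
    then show "k \<in> T K" "l \<in> T L" using that by (auto simp: T_def)
  qed (rule that)
  moreover have "k0 \<in> K" "l0 \<in> L" using kl by (auto simp: T_def)
  ultimately show ?case by blast
qed

text \<open>Over a domain top degrees add: some monomial of degree \<open>D p + D q\<close> arises
  in \<open>p * q\<close> from exactly one pair of terms and survives. Since the product is 1, both
  degrees are 0.\<close>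

lemma mpoly_unit_const:
  fixes p q :: "('v::finite, 'k::idom) mpoly"
  assumes pq: "p * q = 1"
  obtains c where "p = mconst c"
proof -
  define d where "d m = (\<Sum>v\<in>UNIV. Poly_Mapping.lookup m v)" for m :: "'v \<Rightarrow>\<^sub>0 nat"
  have d_add: "d (k + l) = d k + d l" for k l
    by (simp add: d_def lookup_add sum.distrib)
  have d_0: "m = 0" if "d m = 0" for m
    using that by (intro poly_mapping_eqI) (auto simp: d_def)
  define D where "D r = Max (d ` Poly_Mapping.keys r)" for r :: "('v, 'k) mpoly"
  define T where "T r = {m \<in> Poly_Mapping.keys r. d m = D r}" for r
  have le: "d m \<le> D r" if "m \<in> Poly_Mapping.keys r" for m r
    unfolding D_def using that by auto
  have ne: "T r \<noteq> {}" if "r \<noteq> 0" for r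
  proof -
    have "D r \<in> d ` Poly_Mapping.keys r"
      unfolding D_def using that by (intro Max_in) auto
    then show ?thesis by (auto simp: T_def)
  qed
  have nz: "p \<noteq> 0" "q \<noteq> 0" using pq by auto
  \<comment> \<open>Taking all variables for \<open>V\<close> makes the agreement hypotheses outside
    \<open>V\<close> vacuous.\<close>
  have "\<exists>k0\<in>T p. \<exists>l0\<in>T q. \<forall>k\<in>T p. \<forall>l\<in>T q. k + l = k0 + l0 \<longrightarrow> k = k0 \<and> l = l0"
    by (rule ex_unique_sum_lex[of UNIV]) (use nz ne in \<open>auto simp: T_def\<close>)
  then obtain k0 l0 where kl: "k0 \<in> T p" "l0 \<in> T q"
    and uniq: "\<And>k l. k \<in> T p \<Longrightarrow> l \<in> T q \<Longrightarrow> k + l = k0 + l0 \<Longrightarrow> k = k0 \<and> l = l0"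
    by blast
  \<comment> \<open>Comparing total degrees extends uniqueness from the top-degree monomials to the
    full supports.\<close>
  have uniq': "k + l = k0 + l0 \<longleftrightarrow> k = k0 \<and> l = l0"
    if "k \<in> Poly_Mapping.keys p" "l \<in> Poly_Mapping.keys q" for k l
  proof
    assume eq: "k + l = k0 + l0"
    then have "d k + d l = D p + D q"
      using kl d_add by (metis (mono_tags, lifting) T_def mem_Collect_eq)
    then have "d k = D p \<and> d l = D q"
      using le[OF that(1)] le[OF that(2)] by linarith
    then show "k = k0 \<and> l = l0" using that uniq eq by (auto simp: T_def)
  qed auto
  have "Poly_Mapping.lookup (p * q) (k0 + l0) =
      (\<Sum>k\<in>Poly_Mapping.keys p. \<Sum>l\<in>Poly_Mapping.keys q.
        (if l = l0 then (if k = k0 then Poly_Mapping.lookup p k * Poly_Mapping.lookup q l else 0) else 0))"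
    unfolding lookup_mult_keys by (intro sum.cong refl) (auto simp: uniq' when_def)
  also have "\<dots> = Poly_Mapping.lookup p k0 * Poly_Mapping.lookup q l0"
    using kl by (simp add: T_def)
  also have "\<dots> \<noteq> 0" using kl by (auto simp: T_def in_keys_iff)
  finally have "k0 + l0 = 0" using pq by (auto simp: lookup_one when_def split: if_splits)
  then have "d k0 + d l0 = d 0" by (metis d_add)
  then have "D p = 0" using kl by (auto simp: T_def d_def)
  then have "Poly_Mapping.keys p \<subseteq> {0}" using le[of _ p] d_0 by auto
  then have "p = mconst (Poly_Mapping.lookup p 0)"
    by (intro poly_mapping_eqI)
      (auto simp: mconst_def lookup_single when_def in_keys_iff subset_iff)
  then show ?thesis by (rule that)
qed

section \<open>Derivations and the chain rule\<close>

lemma partial_add: "partial v (p + q) = partial v p + partial v q"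
  by (rule poly_mapping_eqI) (simp add: lookup_partial lookup_add distrib_left)

lemma partial_single:
  "partial v (Poly_Mapping.single m a) =
    Poly_Mapping.single (m - Poly_Mapping.single v 1) (of_nat (Poly_Mapping.lookup m v) * a)"
  by (simp add: partial_def)

lemma partial_mconst [simp]: "partial v (mconst c) = 0"
  by (simp add: mconst_def partial_single)

lemma partial_mvar: "partial v (mvar u) = (if u = v then 1 else 0)"
  by (simp add: mvar_def partial_single lookup_single)

lemma partial_mult: "partial v (p * q) = partial v p * q + p * partial v q"
proof (induction p rule: poly_mapping_add_induct)
  case (single m a)
  show ?case
  proof (induction q rule: poly_mapping_add_induct)
    case (single l b)
    let ?e = "Poly_Mapping.single v (1::nat)"
    \<comment> \<open>Truncated subtraction commutes with the sum only when the exponent of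
      \<open>v\<close> is positive; otherwise the coefficient of that term is 0.\<close>
    have 1: "(m - ?e) + l = (m + l) - ?e" if "Poly_Mapping.lookup m v \<noteq> 0"
      using that by (intro poly_mapping_eqI)
        (auto simp: lookup_add lookup_minus lookup_single when_def)
    have 2: "m + (l - ?e) = (m + l) - ?e" if "Poly_Mapping.lookup l v \<noteq> 0"
      using that by (intro poly_mapping_eqI)
        (auto simp: lookup_add lookup_minus lookup_single when_def)
    show ?case
      using 1 2
      by (cases "Poly_Mapping.lookup m v = 0"; cases "Poly_Mapping.lookup l v = 0")
        (simp_all add: mult_single partial_single lookup_add single_add[symmetric] algebra_simps)
  qed (simp add: partial_add algebra_simps)
qed (simp add: partial_add algebra_simps)

lemma partial_mconst_mult: "partial v (mconst c * p) = mconst c * partial v p"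
  by (simp add: partial_mult)

text \<open>If \<open>v\<close> occurs in \<open>m\<close>, the coefficient of \<open>m\<close> in
  \<open>p\<close>, times the exponent of \<open>v\<close>, is a coefficient of
  \<open>partial v p\<close>; in characteristic 0 that exponent is invertible.\<close>

lemma mconst_of_partial_eq_0:
  fixes p :: "('v, 'k::field_char_0) mpoly"
  assumes "\<And>v. partial v p = 0"
  obtains c where "p = mconst c"
proof -
  have "Poly_Mapping.lookup p m = 0" if "m \<noteq> 0" for m
  proof -
    have "\<exists>v. Poly_Mapping.lookup m v \<noteq> 0"
      using that poly_mapping_eqI[of m 0] by (metis lookup_zero)
    then obtain v where v: "Poly_Mapping.lookup m v \<noteq> 0" ..
    let ?l = "m - Poly_Mapping.single v (1::nat)"
    have m: "?l + Poly_Mapping.single v 1 = m"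
      using v by (intro poly_mapping_eqI) (auto simp: lookup_add lookup_minus lookup_single when_def)
    show ?thesis
      using lookup_partial[of v p ?l] assms[of v] unfolding m by (simp del: of_nat_Suc)
  qed
  then have "p = mconst (Poly_Mapping.lookup p 0)"
    by (intro poly_mapping_eqI) (auto simp: mconst_def lookup_single when_def)
  then show ?thesis by (rule that)
qed

section \<open>Algebra endomorphisms and determinants\<close>

context
  fixes \<sigma> :: "('v, 'k::comm_ring_1) mpoly \<Rightarrow> ('v, 'k) mpoly"
  assumes hom: "alg_hom \<sigma>"
begin

lemma alg_hom_1: "\<sigma> 1 = 1"
  and alg_hom_add: "\<sigma> (p + q) = \<sigma> p + \<sigma> q"
  and alg_hom_mult: "\<sigma> (p * q) = \<sigma> p * \<sigma> q"
  using hom by (auto simp: alg_hom_def)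

lemma alg_hom_mconst: "\<sigma> (mconst c) = mconst c"
  using hom by (metis alg_hom_def mult.right_neutral)

lemma alg_hom_0: "\<sigma> 0 = 0"
  using alg_hom_mconst[of 0] by simp

lemma alg_hom_uminus: "\<sigma> (- p) = - \<sigma> p"
  by (metis add.right_inverse alg_hom_0 alg_hom_add minus_unique)

lemma alg_hom_sum: "\<sigma> (sum f A) = (\<Sum>i\<in>A. \<sigma> (f i))"
  by (induction A rule: infinite_finite_induct) (auto simp: alg_hom_0 alg_hom_add)

lemma alg_hom_prod: "\<sigma> (prod f A) = (\<Prod>i\<in>A. \<sigma> (f i))"
  by (induction A rule: infinite_finite_induct) (auto simp: alg_hom_1 alg_hom_mult)

lemma alg_hom_sign: "\<sigma> (of_int (sign p)) = of_int (sign p)"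
  by (simp add: sign_def alg_hom_1 alg_hom_uminus)

text \<open>The determinant is a polynomial in the entries with coefficients 1 and -1, which
  \<sigma> fixes.\<close>

lemma alg_hom_det: "\<sigma> (det M) = det (\<chi> i j. \<sigma> (M $ i $ j))"
  by (simp add: det_def alg_hom_sum alg_hom_mult alg_hom_prod alg_hom_sign)

end

text \<open>Both sides are additive in \<open>p\<close>, obey the same Leibniz rule twisted by
  \<sigma>, and agree on constants and variables.\<close>

lemma partial_alg_hom:
  fixes \<sigma> :: "('v::finite, 'k::comm_ring_1) mpoly \<Rightarrow> ('v, 'k) mpoly"
  assumes hom: "alg_hom \<sigma>"
  shows "partial j (\<sigma> p) = (\<Sum>k\<in>UNIV. \<sigma> (partial k p) * partial j (\<sigma> (mvar k)))"
proof (induction p rule: mpoly_induct)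
  case (const c)
  show ?case by (simp add: alg_hom_mconst[OF hom] alg_hom_0[OF hom])
next
  case (var v)
  have "\<sigma> (partial k (mvar v)) * partial j (\<sigma> (mvar k)) =
      (if k = v then partial j (\<sigma> (mvar v)) else 0)" for k
    by (simp add: partial_mvar alg_hom_0[OF hom] alg_hom_1[OF hom])
  then show ?case by simp
next
  case (add p q)
  then show ?case
    by (simp add: partial_add alg_hom_add[OF hom] distrib_right sum.distrib)
next
  case (mult p q)
  then show ?case
    by (simp add: partial_mult alg_hom_add[OF hom] alg_hom_mult[OF hom]
        sum.distrib sum_distrib_left sum_distrib_right algebra_simps)
qed

text \<open>The chain rule is a factorization of matrices, and the determinant is
  multiplicative.\<close>

lemma jacobian_alg_hom:
  fixes \<sigma> :: "('v::finite, 'k::comm_ring_1) mpoly \<Rightarrow> ('v, 'k) mpoly"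
  assumes hom: "alg_hom \<sigma>"
  shows "jacobian (\<lambda>i. \<sigma> (f i)) = \<sigma> (jacobian f) * jacobian (\<lambda>k. \<sigma> (mvar k))"
proof -
  have "(\<chi> i j. partial j (\<sigma> (f i))) =
      (\<chi> i j. \<sigma> (partial j (f i))) ** (\<chi> i j. partial j (\<sigma> (mvar i)))"
    by (simp add: matrix_matrix_mult_def vec_eq_iff partial_alg_hom[OF hom, of _ "f _"])
  then show ?thesis
    by (simp add: jacobian_def det_mul alg_hom_det[OF hom])
qed

section \<open>The Jacobian of an automorphism\<close>

lemma jacobian_mvar:
  "jacobian (mvar :: 'v::finite \<Rightarrow> ('v, 'k::comm_ring_1) mpoly) = 1"
proof -
  have "(\<chi> i j. partial j (mvar i :: ('v, 'k) mpoly)) = mat 1"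
    by (simp add: mat_def vec_eq_iff partial_mvar)
  then show ?thesis by (simp add: jacobian_def)
qed

lemma jacobian_automorphism_const:
  fixes \<sigma> :: "('v::finite, 'k::idom) mpoly \<Rightarrow> ('v, 'k) mpoly"
  assumes "\<sigma> \<in> carrier Aut_alg"
  obtains c where "c \<noteq> 0" "jacobian (\<lambda>k. \<sigma> (mvar k)) = mconst c"
proof -
  have hom: "alg_hom \<sigma>" and surj: "surj \<sigma>"
    using assms by (auto simp: Aut_alg_def bij_is_surj)
  \<comment> \<open>These are the images of the variables under the inverse of \<sigma>; the chain
    rule for them exhibits the Jacobian of \<sigma> as a unit.\<close>
  define f where "f k = inv_into UNIV \<sigma> (mvar k)" for k
  have "(\<lambda>k. \<sigma> (f k)) = mvar"
    using surj by (simp add: f_def surj_f_inv_f fun_eq_iff)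
  then have 1: "jacobian (\<lambda>k. \<sigma> (mvar k)) * \<sigma> (jacobian f) = 1"
    using jacobian_alg_hom[OF hom, of f] by (simp add: jacobian_mvar mult.commute)
  then obtain c where c: "jacobian (\<lambda>k. \<sigma> (mvar k)) = mconst c"
    by (rule mpoly_unit_const)
  with 1 have "c \<noteq> 0" by auto
  then show ?thesis using c by (rule that)
qed

section \<open>The bracket\<close>

lemma nambu_bracket_alg_hom:
  fixes \<sigma> :: "('m::finite option, 'k::comm_ring_1) mpoly \<Rightarrow> ('m option, 'k) mpoly"
  assumes "alg_hom \<sigma>"
  shows "nambu_bracket (\<sigma> \<Omega>) (\<lambda>i. \<sigma> (f i)) =
    \<sigma> (nambu_bracket \<Omega> f) * jacobian (\<lambda>k. \<sigma> (mvar k))"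
proof -
  have "case_option (\<sigma> \<Omega>) (\<lambda>i. \<sigma> (f i)) = (\<lambda>i. \<sigma> (case_option \<Omega> f i))"
    by (auto simp: fun_eq_iff split: option.split)
  then show ?thesis
    unfolding nambu_bracket_def using jacobian_alg_hom[OF assms] by metis
qed

text \<open>This isolates the row of \<Omega> in the shape that the row rules for \<open>det\<close>
  expect. The default 0 in \<open>case_option\<close> is never read, since the row
  \<open>None\<close> is treated separately.\<close>

lemma nambu_bracket_row:
  "nambu_bracket \<Omega> f = det (\<chi> i. if i = None then (\<chi> j. partial j \<Omega>)
     else (\<chi> j. partial j (case_option 0 f i)))"
  unfolding nambu_bracket_def jacobian_def
  by (intro arg_cong[where f = det]) (auto simp: vec_eq_iff split: option.split)

lemma nambu_bracket_affine:
  "nambu_bracket (mconst a * P + Q) f = mconst a * nambu_bracket P f + nambu_bracket Q f"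
proof -
  have "(\<chi> j. partial j (mconst a * P + Q)) =
      mconst a *s (\<chi> j. partial j P) + (\<chi> j. partial j Q)"
    by (simp add: vec_eq_iff partial_add partial_mconst_mult)
  then show ?thesis
    unfolding nambu_bracket_row
    using det_row_add[of None "\<lambda>_. mconst a *s (\<chi> j. partial j P)" "\<lambda>_. \<chi> j. partial j Q"]
      det_row_mul[of None "mconst a" "\<lambda>_. \<chi> j. partial j P"]
    by (simp cong: if_cong)
qed

lemma nambu_bracket_mconst: "nambu_bracket (mconst b) f = 0"
  unfolding nambu_bracket_row
  using det_row_0[of None] by (simp add: zero_vec_def cong: if_cong)

text \<open>All rows but \<open>None\<close> are unit vectors, so only \<pi> contributes to the
  Leibniz expansion. The permutation \<pi> selects which variable is left out.\<close>

lemma nambu_bracket_mvar: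
  fixes P :: "('m::finite option, 'k::comm_ring_1) mpoly"
  assumes perm: "\<pi> permutes UNIV"
  shows "nambu_bracket P (\<lambda>i. mvar (\<pi> (Some i))) = of_int (sign \<pi>) * partial (\<pi> None) P"
proof -
  let ?A = "\<lambda>i j. partial j (case_option P (\<lambda>i. mvar (\<pi> (Some i))) i)"
  have prod: "(\<Prod>i\<in>UNIV. ?A i (p i)) = (if p = \<pi> then partial (\<pi> None) P else 0)"
    if p: "p permutes UNIV" for p
  proof -
    have expand: "(\<Prod>i\<in>UNIV. ?A i (p i)) =
        partial (p None) P * (\<Prod>i\<in>UNIV. if \<pi> (Some i) = p (Some i) then 1 else 0)"
      by (simp add: UNIV_option_conv prod.reindex partial_mvar)
    have "p = \<pi>" if "\<And>i. \<pi> (Some i) = p (Some i)"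
    proof -
      \<comment> \<open>Agreement off \<open>None\<close> forces agreement at \<open>None\<close>: a
        preimage \<open>Some i\<close> would give \<pi> the same value at \<open>None\<close> and
        \<open>Some i\<close>.\<close>
      have "inv_into UNIV p (\<pi> None) = None"
      proof (cases "inv_into UNIV p (\<pi> None)")
        case (Some i)
        then have "\<pi> None = \<pi> (Some i)"
          using that p by (metis permutes_inverses(1))
        then show ?thesis using perm by (metis option.distinct(1) permutes_inverses(2))
      qed
      then have "p None = \<pi> None" using p by (metis permutes_inverses(1))
      then show ?thesis using that by (intro ext) (metis option.exhaust)
    qed
    then have "\<exists>i. \<pi> (Some i) \<noteq> p (Some i)" if "p \<noteq> \<pi>" using that by blast
    then have "(\<Prod>i\<in>UNIV. if \<pi> (Some i) = p (Some i) then 1 else 0) =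
        (if p = \<pi> then 1 else 0 :: ('m option, 'k) mpoly)"
      by (auto intro!: prod_zero)
    then show ?thesis by (simp add: expand)
  qed
  have "nambu_bracket P (\<lambda>i. mvar (\<pi> (Some i))) =
      (\<Sum>p | p permutes UNIV. if p = \<pi> then of_int (sign \<pi>) * partial (\<pi> None) P else 0)"
    unfolding nambu_bracket_def jacobian_def det_def
    by (intro sum.cong refl) (simp add: prod)
  then show ?thesis using perm by (simp add: finite_permutations)
qed

lemma mconst_of_nambu_bracket_eq_0:
  fixes P :: "('m::finite option, 'k::field_char_0) mpoly"
  assumes "\<And>g. nambu_bracket P g = 0"
  obtains c where "P = mconst c"
proof (rule mconst_of_partial_eq_0)
  fix v :: "'m option"
  \<comment> \<open>This permutation sends \<open>None\<close> to \<open>v\<close>, so the bracket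
    with all other variables is \<open>partial v P\<close> up to sign.\<close>
  let ?\<pi> = "Transposition.transpose None v"
  have "of_int (sign ?\<pi>) * partial v P = 0"
    using nambu_bracket_mvar[of ?\<pi> P] assms by (simp add: permutes_swap_id)
  then show "partial v P = 0" by (auto simp: sign_def split: if_splits)
qed

section \<open>The two automorphism groups\<close>

lemma subgroup_Aut_affine:
  fixes \<Omega> :: "('v, 'k::field) mpoly"
  shows "subgroup (Aut_affine \<Omega>) Aut_alg"
proof (rule group.subgroupI[OF group_Aut_alg])
  show "Aut_affine \<Omega> \<subseteq> carrier Aut_alg" by (auto simp: Aut_affine_def)
  have "id \<in> carrier (Aut_alg :: (('v, 'k) mpoly \<Rightarrow> ('v, 'k) mpoly) monoid)"
    by (simp add: Aut_alg_def alg_hom_def)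
  moreover have "id \<Omega> = mconst 1 * \<Omega> + mconst 0" by simp
  ultimately have "id \<in> Aut_affine \<Omega>"
    unfolding Aut_affine_def using one_neq_zero by blast
  then show "Aut_affine \<Omega> \<noteq> {}" by blast
next
  fix \<sigma> assume \<sigma>: "\<sigma> \<in> Aut_affine \<Omega>"
  let ?\<tau> = "inv\<^bsub>Aut_alg\<^esub> \<sigma>"
  obtain a b where ab: "a \<noteq> 0" "\<sigma> \<Omega> = mconst a * \<Omega> + mconst b" and car: "\<sigma> \<in> carrier Aut_alg"
    using \<sigma> by (auto simp: Aut_affine_def)
  have \<tau>: "?\<tau> \<in> carrier Aut_alg" using car by (rule group.inv_closed[OF group_Aut_alg])
  then have hom: "alg_hom ?\<tau>" by (simp add: Aut_alg_def)
  have "?\<tau> \<circ> \<sigma> = id"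
    using group.l_inv[OF group_Aut_alg car] by (simp add: Aut_alg_def)
  \<comment> \<open>Applying the inverse to the affine relation gives an equation to be solved for
    its value at \<Omega>.\<close>
  then have "\<Omega> = ?\<tau> (\<sigma> \<Omega>)" by (metis comp_apply id_apply)
  also have "\<dots> = mconst a * ?\<tau> \<Omega> + mconst b"
    by (simp add: ab alg_hom_add[OF hom] alg_hom_mult[OF hom] alg_hom_mconst[OF hom])
  finally have "mconst (inverse a) * \<Omega> = mconst (inverse a) * (mconst a * ?\<tau> \<Omega> + mconst b)"
    by (rule arg_cong)
  also have "\<dots> = mconst (inverse a * a) * ?\<tau> \<Omega> + mconst (inverse a * b)"
    by (simp only: mconst_mult distrib_left mult.assoc)
  finally have "mconst (inverse a) * \<Omega> =
      mconst (inverse a * a) * ?\<tau> \<Omega> + mconst (inverse a * b)" .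
  then have "?\<tau> \<Omega> = mconst (inverse a) * \<Omega> + mconst (- (inverse a * b))"
    using ab(1) mconst_add[of "inverse a * b" "- (inverse a * b)"] by (simp add: add.assoc)
  then show "?\<tau> \<in> Aut_affine \<Omega>"
    using \<tau> ab(1) unfolding Aut_affine_def
    by (intro CollectI conjI exI[of _ "inverse a"] exI[of _ "- (inverse a * b)"]) auto
next
  fix \<sigma> \<tau> assume "\<sigma> \<in> Aut_affine \<Omega>" "\<tau> \<in> Aut_affine \<Omega>"
  then obtain a b a' b' where *: "a \<noteq> 0" "\<sigma> \<Omega> = mconst a * \<Omega> + mconst b" "\<sigma> \<in> carrier Aut_alg"
      "a' \<noteq> 0" "\<tau> \<Omega> = mconst a' * \<Omega> + mconst b'" "\<tau> \<in> carrier Aut_alg"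
    by (auto simp: Aut_affine_def)
  then have hom: "alg_hom \<sigma>" by (simp add: Aut_alg_def)
  have "(\<sigma> \<circ> \<tau>) \<Omega> = mconst (a' * a) * \<Omega> + mconst (a' * b + b')"
    by (simp add: * alg_hom_add[OF hom] alg_hom_mult[OF hom] alg_hom_mconst[OF hom]
        mconst_add mconst_mult algebra_simps)
  moreover have "\<sigma> \<circ> \<tau> \<in> carrier Aut_alg"
    using * by (auto simp: Aut_alg_def alg_hom_comp bij_comp)
  moreover have "a' * a \<noteq> 0" using * by simp
  ultimately have "\<sigma> \<circ> \<tau> \<in> Aut_affine \<Omega>" unfolding Aut_affine_def by blast
  then show "\<sigma> \<otimes>\<^bsub>Aut_alg\<^esub> \<tau> \<in> Aut_affine \<Omega>" by (simp add: Aut_alg_def)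
qed

lemma Aut_affine_eq_Aut_eps_Poi:
  fixes \<Omega> :: "('m::finite option, 'k::field_char_0) mpoly"
  shows "Aut_affine \<Omega> = Aut_eps_Poi (nambu_bracket \<Omega>)"
proof (intro equalityI subsetI)
  fix \<sigma> assume "\<sigma> \<in> Aut_affine \<Omega>"
  then obtain a b where car: "\<sigma> \<in> carrier Aut_alg" and a: "a \<noteq> 0"
    and \<sigma>\<Omega>: "\<sigma> \<Omega> = mconst a * \<Omega> + mconst b"
    by (auto simp: Aut_affine_def)
  then have hom: "alg_hom \<sigma>" by (simp add: Aut_alg_def)
  obtain c where c: "c \<noteq> 0" "jacobian (\<lambda>k. \<sigma> (mvar k)) = mconst c"
    using jacobian_automorphism_const[OF car] .
  have "\<sigma> (nambu_bracket \<Omega> f) = mconst (a / c) * nambu_bracket \<Omega> (\<lambda>i. \<sigma> (f i))" for f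
  proof -
    have "\<sigma> (nambu_bracket \<Omega> f) * mconst c = mconst a * nambu_bracket \<Omega> (\<lambda>i. \<sigma> (f i))"
      using nambu_bracket_alg_hom[OF hom, of \<Omega> f]
      by (simp add: c \<sigma>\<Omega> nambu_bracket_affine nambu_bracket_mconst)
    \<comment> \<open>Division by the Jacobian is multiplication by the constant polynomial of
      \<open>inverse c\<close>.\<close>
    then have "mconst (inverse c) * (\<sigma> (nambu_bracket \<Omega> f) * mconst c) =
        mconst (inverse c) * (mconst a * nambu_bracket \<Omega> (\<lambda>i. \<sigma> (f i)))"
      by (rule arg_cong)
    then have "mconst (inverse c * c) * \<sigma> (nambu_bracket \<Omega> f) =
        mconst (inverse c * a) * nambu_bracket \<Omega> (\<lambda>i. \<sigma> (f i))"
      by (simp only: mconst_mult mult_ac)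
    then show ?thesis using c by (simp add: divide_inverse mult.commute)
  qed
  then have "nambu_poisson_morphism (nambu_bracket \<Omega>) (scaled_bracket (a / c) (nambu_bracket \<Omega>)) \<sigma>"
    using hom by (simp add: nambu_poisson_morphism_def scaled_bracket_def)
  moreover have "a / c \<noteq> 0" using a c by simp
  ultimately show "\<sigma> \<in> Aut_eps_Poi (nambu_bracket \<Omega>)"
    using car unfolding Aut_eps_Poi_def by blast
next
  fix \<sigma> assume "\<sigma> \<in> Aut_eps_Poi (nambu_bracket \<Omega>)"
  then obtain e where car: "\<sigma> \<in> carrier Aut_alg" and e: "e \<noteq> 0"
    and br: "\<And>f. \<sigma> (nambu_bracket \<Omega> f) = mconst e * nambu_bracket \<Omega> (\<lambda>i. \<sigma> (f i))"
    by (auto simp: Aut_eps_Poi_def nambu_poisson_morphism_def scaled_bracket_def)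
  then have hom: "alg_hom \<sigma>" and surj: "surj \<sigma>"
    by (auto simp: Aut_alg_def bij_is_surj)
  obtain c where c: "c \<noteq> 0" "jacobian (\<lambda>k. \<sigma> (mvar k)) = mconst c"
    using jacobian_automorphism_const[OF car] .
  \<comment> \<open>The factor \<open>e * c\<close> is the only candidate for the slope:
    \<open>e\<close> comes from the bracket, \<open>c\<close> from the Jacobian.\<close>
  define P where "P = \<sigma> \<Omega> - mconst (e * c) * \<Omega>"
  have \<sigma>\<Omega>: "\<sigma> \<Omega> = mconst (e * c) * \<Omega> + P" by (simp add: P_def)
  have "nambu_bracket P g = 0" for g
  proof -
    \<comment> \<open>Surjectivity of \<sigma> makes every family \<open>g\<close> an image, so the
      bracket with \<open>P\<close> vanishes on all arguments.\<close>
    define f where "f i = inv_into UNIV \<sigma> (g i)" for i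
    have g: "(\<lambda>i. \<sigma> (f i)) = g" using surj by (simp add: f_def surj_f_inv_f)
    have "nambu_bracket (\<sigma> \<Omega>) g = mconst (e * c) * nambu_bracket \<Omega> g"
      using nambu_bracket_alg_hom[OF hom, of \<Omega> f] br[of f]
      by (simp add: g c mconst_mult mult_ac)
    then show ?thesis by (simp add: \<sigma>\<Omega> nambu_bracket_affine)
  qed
  then obtain b where "P = mconst b" by (rule mconst_of_nambu_bracket_eq_0)
  then have "\<sigma> \<Omega> = mconst (e * c) * \<Omega> + mconst b" using \<sigma>\<Omega> by simp
  moreover have "e * c \<noteq> 0" using e c by simp
  ultimately show "\<sigma> \<in> Aut_affine \<Omega>"
    using car unfolding Aut_affine_def by blast
qed

theorem theorem6p3:
  fixes \<Omega> :: "('m::finite option, 'k::field_char_0) mpoly"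
  assumes "CARD('m) \<ge> 3"
    and "irreducible \<Omega>"
    and "total_degree \<Omega> \<ge> 2"
  shows "subgroup (Aut_affine \<Omega>) Aut_alg \<and>
    subgroup (Aut_eps_Poi (nambu_bracket \<Omega>)) Aut_alg \<and>
    Aut_affine \<Omega> = Aut_eps_Poi (nambu_bracket \<Omega>)"
  \<comment> \<open>The subgroup property of the \<epsilon>-automorphisms is transported along the
    equality of the two sets.\<close>
  using subgroup_Aut_affine[of \<Omega>] Aut_affine_eq_Aut_eps_Poi[of \<Omega>] by simp

end
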